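(* Let $\bar p\in\mathbb{H}^n$ and $r>0$, let $\tau_{\bar p}:\mathbb{H}^n\to\mathbb{H}^n$, $\tau_{\bar p}(p)=\bar p*p$, be the left translation and $\delta_r:\mathbb{H}^n\to\mathbb{H}^n$, $\delta_r(x,y,t)=(rx,ry,r^2t)$, the anisotropic dilation, and let $S\subseteq\mathbb{H}^n$ be an $\mathbb{H}$-regular $1$-codimensional surface (which, so that $\mathbb{H}$-orientability is defined, is a $1$-codimensional $C^1$-Euclidean surface with $C(S)=\varnothing$). Then the $\mathbb{H}$-regular $1$-codimensional surfaces $\tau_{\bar p}S=\{\bar p*p:p\in S\}$ and $\delta_rS=\{\delta_r(p):p\in S\}$ are (respectively) $\mathbb{H}$-orientable if and only if $S$ is $\mathbb{H}$-orientable.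
   Context: The Heisenberg group $\mathbb{H}^n$, $n\geq1$, is $\mathbb{R}^{2n+1}$ with coordinates $(x,y,t)$, $x,y\in\mathbb{R}^n$, $t\in\mathbb{R}$, and product $(x,y,t)*(x',y',t')=(x+x',y+y',t+t'+\frac12\sum_j(x_jy_j'-y_jx_j'))$. The standard left invariant vector fields are $X_j=\partial_{x_j}-\frac12y_j\partial_t$, $Y_j=\partial_{y_j}+\frac12x_j\partial_t$ ($j=1,\dots,n$), $T=\partial_t$. The horizontal layer is $\mathfrak{h}_1=\operatorname{span}\{X_j,Y_j:j=1,\dots,n\}$ (at a point $p$: $\mathfrak{h}_{1,p}$), with scalar product $\langle\cdot,\cdot\rangle_H$ making the $X_j,Y_j$ orthonormal. A function $f:U\to\mathbb{R}$, $U\subseteq\mathbb{H}^n$ open, is P-differentiable at $p_0\in U$ if there is a (unique) group homomorphism $d_Hf_{p_0}:\mathbb{H}^n\to\mathbb{R}$ with $d_Hf_{p_0}(\delta_\rho p)=\rho\,d_Hf_{p_0}(p)$ for all $\rho>0$ such that $d_Hf_{p_0}(p)=\lim_{\rho\to0}\frac{f(p_0*\delta_\rho(p))-f(p_0)}{\rho}$ uniformly for $p$ in compact sets. Its horizontal gradient is $\nabla_{\mathbb{H}}f=\sum_{j=1}^n[(X_jf)X_j+(Y_jf)Y_j]$. $C^1_{\mathbb{H}}(U,\mathbb{R})$ is the space of continuous $f:U\to\mathbb{R}$ such that $\nabla_{\mathbb{H}}f$ is continuous in $U$ (equivalently, such that the P-differential is continuous). A subset $S\subseteq\mathbb{H}^n$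 is an $\mathbb{H}$-regular $1$-codimensional surface if for every $p\in S$ there are a neighbourhood $U$ of $p$ and $f\in C^1_{\mathbb{H}}(U,\mathbb{R})$ with $S\cap U=\{f=0\}$ and $\nabla_{\mathbb{H}}f\neq0$ on $U$; its horizontal normal vector field is, locally, $\nabla_{\mathbb{H}}f/|\nabla_{\mathbb{H}}f|$. $\mathbb{H}$-regularity of $1$-codimensional surfaces is preserved by left translations and by the dilations $\delta_r$. A $1$-codimensional $C^1$-Euclidean surface $S\subseteq\mathbb{H}^n$ is a subset such that for every $p\in S$ there are a neighbourhood $U$ of $p$ and $g\in C^1(U,\mathbb{R})$ (ordinary Euclidean $C^1$) with $S\cap U=\{g=0\}$ and $\nabla g\neq0$ on $U$ ($\nabla$ the Euclidean gradient). $TS$ denotes the space of vector fields tangent to $S$, $T_pS$ the space of vectors tangent to $S$ at $p$, and the characteristic set is $C(S)=\{p\in S:T_pS\subseteq\mathfrak{h}_{1,p}\}$. If $C(S)=\varnothing$, such a surface is $\mathbb{H}$-regular. Let $S$ be a $1$-codimensional $C^1$-Euclidean surface with $C(S)=\varnothing$. A vector $v\in\mathfrak{h}_1$ and $S$ are $\mathbb{H}$-orthogonal if $\langle v,w_{|\mathfrak{h}_1}\rangle_H=0$ for all $w\in TS$, where $w_{|\mathfrak{h}_1}$ is the restriction of $w$ to $\mathfrak{h}_1$ (its horizontal part). $S$ is $\mathbb{H}$-orientable if there is a continuous horizontal global never-null vector field $n_{\mathbb{H}}=\sum_{i=1}^n(n_{\mathbb{H},i}X_i+n_{\mathbb{H},n+i}Y_i)\neq0$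 defined on $S$ so that $n_{\mathbb{H}}$ and $S$ are $\mathbb{H}$-orthogonal; this $n_{\mathbb{H}}$ is stated to be consistent with the local horizontal normal above. *)

theory Defs
  imports "HOL-Analysis.Analysis"
begin

text \<open>Points of the Heisenberg group, and vectors at a point, are triples \<open>(x, y, t)\<close>; the
  topology is the Euclidean one. The index type \<open>'n\<close> has \<open>n \<ge> 1\<close> elements.\<close>

type_synonym 'n heis = "(real ^ 'n) \<times> (real ^ 'n) \<times> real"

definition hmul :: "'n::finite heis \<Rightarrow> 'n heis \<Rightarrow> 'n heis" where
  "hmul p q = (case p of (x, y, t) \<Rightarrow> case q of (x', y', t') \<Rightarrow>
     (x + x', y + y', t + t' + 1/2 * (\<Sum>j\<in>UNIV. x $ j * y' $ j - y $ j * x' $ j)))"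

definition left_transl :: "'n::finite heis \<Rightarrow> 'n heis \<Rightarrow> 'n heis" where
  "left_transl a = (\<lambda>p. hmul a p)"

definition dil :: "real \<Rightarrow> 'n::finite heis \<Rightarrow> 'n heis" where
  "dil r p = (case p of (x, y, t) \<Rightarrow> (r *\<^sub>R x, r *\<^sub>R y, r\<^sup>2 * t))"

subsection \<open>Left invariant vector fields and the horizontal layer\<close>

definition Xf :: "'n::finite \<Rightarrow> 'n heis \<Rightarrow> 'n heis" where
  "Xf j p = (axis j 1, 0, - (1/2) * (fst (snd p) $ j))"

definition Yf :: "'n::finite \<Rightarrow> 'n heis \<Rightarrow> 'n heis" where
  "Yf j p = (0, axis j 1, 1/2 * (fst p $ j))"

definition Tf :: "'n::finite heis \<Rightarrow> 'n heis" where
  "Tf p = (0, 0, 1)"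

definition hlayer :: "'n::finite heis \<Rightarrow> 'n heis set" where
  "hlayer p = span (range (\<lambda>j. Xf j p) \<union> range (\<lambda>j. Yf j p))"

text \<open>If \<open>v = \<Sum>j. a j X j + b j Y j + c T\<close> at some point, then \<open>a\<close> and \<open>b\<close> are the first two
  components of \<open>v\<close>; on each horizontal layer \<open>inner_H\<close> is thus the scalar product making the
  \<open>X j\<close>, \<open>Y j\<close> orthonormal.\<close>

definition inner_H :: "'n::finite heis \<Rightarrow> 'n heis \<Rightarrow> real" where
  "inner_H v w = fst v \<bullet> fst w + fst (snd v) \<bullet> fst (snd w)"

definition hpart :: "'n::finite heis \<Rightarrow> 'n heis \<Rightarrow> 'n heis" where
  "hpart p v = (\<Sum>j\<in>UNIV. (fst v $ j) *\<^sub>R Xf j p + (fst (snd v) $ j) *\<^sub>R Yf j p)"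

lemma inner_H_orthonormal:
  "inner_H (Xf j p) (Xf k p) = (if j = k then 1 else 0)"
  "inner_H (Yf j p) (Yf k p) = (if j = k then 1 else 0)"
  "inner_H (Xf j p) (Yf k p) = 0"
  by (simp_all add: inner_H_def Xf_def Yf_def inner_axis_axis)

lemma fst_hpart: "fst (hpart p v) = fst v"
  by (simp add: hpart_def fst_sum Xf_def Yf_def vec_eq_iff axis_def if_distrib cong: if_cong)

lemma fst_snd_hpart: "fst (snd (hpart p v)) = fst (snd v)"
  by (simp add: hpart_def fst_sum snd_sum Xf_def Yf_def vec_eq_iff axis_def if_distrib cong: if_cong)

lemma hpart_decomp: "v = hpart p v + (snd (snd v) - snd (snd (hpart p v))) *\<^sub>R Tf p"
  by (simp add: prod_eq_iff fst_hpart fst_snd_hpart Tf_def)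

lemma hpart_in_hlayer: "hpart p v \<in> hlayer p"
  unfolding hpart_def hlayer_def
  by (intro span_sum span_add span_scale span_base) auto

subsection \<open>P-differentiability and \<open>\<bbbH>\<close>-regular surfaces\<close>

definition P_differentiable_at :: "('n::finite heis \<Rightarrow> real) \<Rightarrow> 'n heis \<Rightarrow> bool" where
  "P_differentiable_at f p0 \<longleftrightarrow>
     (\<exists>L. (\<forall>p q. L (hmul p q) = L p + L q) \<and>
          (\<forall>\<rho>>0. \<forall>p. L (dil \<rho> p) = \<rho> * L p) \<and>
          (\<forall>K. compact K \<longrightarrow>
             uniform_limit K (\<lambda>\<rho> p. (f (hmul p0 (dil \<rho> p)) - f p0) / \<rho>) L (at_right 0)))"

text \<open>The integral curve of \<open>X j\<close> (of \<open>Y j\<close>) through \<open>p\<close> is the line \<open>p + s X j p\<close>, so the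
  derivative along the field is a derivative along this line.\<close>

definition along :: "('n::finite heis \<Rightarrow> 'n heis) \<Rightarrow> ('n heis \<Rightarrow> real) \<Rightarrow> 'n heis \<Rightarrow> real" where
  "along V f p = deriv (\<lambda>s::real. f (p + s *\<^sub>R V p)) 0"

definition hgrad :: "('n::finite heis \<Rightarrow> real) \<Rightarrow> 'n heis \<Rightarrow> 'n heis" where
  "hgrad f p = (\<Sum>j\<in>UNIV. along (Xf j) f p *\<^sub>R Xf j p + along (Yf j) f p *\<^sub>R Yf j p)"

definition C1_H_on :: "'n::finite heis set \<Rightarrow> ('n heis \<Rightarrow> real) \<Rightarrow> bool" where
  "C1_H_on U f \<longleftrightarrow> continuous_on U f \<and> (\<forall>p\<in>U. P_differentiable_at f p) \<and>
     continuous_on U (hgrad f)"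

definition H_regular_surface :: "'n::finite heis set \<Rightarrow> bool" where
  "H_regular_surface S \<longleftrightarrow>
     (\<forall>p\<in>S. \<exists>U f. open U \<and> p \<in> U \<and> C1_H_on U f \<and> S \<inter> U = {q \<in> U. f q = 0} \<and>
        (\<forall>q\<in>U. hgrad f q \<noteq> 0))"

subsection \<open>Euclidean surfaces, tangent vectors and the characteristic set\<close>

definition C1_surface :: "'n::finite heis set \<Rightarrow> bool" where
  "C1_surface S \<longleftrightarrow>
     (\<forall>p\<in>S. \<exists>U g grad. open U \<and> p \<in> U \<and> (\<forall>q\<in>U. GDERIV g q :> grad q) \<and>
        continuous_on U grad \<and> S \<inter> U = {q \<in> U. g q = 0} \<and> (\<forall>q\<in>U. grad q \<noteq> 0))"

definition tangent_space :: "'n::finite heis set \<Rightarrow> 'n heis \<Rightarrow> 'n heis set" where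
  "tangent_space S p =
     {v. \<exists>\<gamma> \<epsilon>. \<epsilon> > 0 \<and> \<gamma> C1_differentiable_on {-\<epsilon><..<\<epsilon>} \<and> \<gamma> ` {-\<epsilon><..<\<epsilon>} \<subseteq> S \<and>
        \<gamma> 0 = p \<and> (\<gamma> has_vector_derivative v) (at (0::real))}"

definition tangent_fields :: "'n::finite heis set \<Rightarrow> ('n heis \<Rightarrow> 'n heis) set" where
  "tangent_fields S = {w. continuous_on S w \<and> (\<forall>p\<in>S. w p \<in> tangent_space S p)}"

definition char_set :: "'n::finite heis set \<Rightarrow> 'n heis set" where
  "char_set S = {p \<in> S. tangent_space S p \<subseteq> hlayer p}"

subsection \<open>\<open>\<bbbH>\<close>-orthogonality and \<open>\<bbbH>\<close>-orientability\<close>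

text \<open>For a tangent field \<open>w\<close>, the restriction of \<open>w\<close> to the horizontal layer can be read as the
  horizontal component \<open>hpart p (w p)\<close> of \<open>w\<close>, for every tangent \<open>w\<close> (first definition), or as
  letting only those tangent \<open>w\<close> count that lie in the horizontal layer (second definition).
  Under the first reading a nonzero horizontal vector at \<open>p\<close> is orthogonal to the surface only
  where \<open>T\<close> is tangent to it; under the second one the orthogonal horizontal vectors at \<open>p\<close> are the
  multiples of the local horizontal normal.\<close>

definition H_orthogonal :: "('n::finite heis \<Rightarrow> 'n heis) \<Rightarrow> 'n heis set \<Rightarrow> bool" where
  "H_orthogonal v S \<longleftrightarrow>
     (\<forall>w\<in>tangent_fields S. \<forall>p\<in>S. inner_H (v p) (hpart p (w p)) = 0)"

definition H_orthogonal_hor :: "('n::finite heis \<Rightarrow> 'n heis) \<Rightarrow> 'n heis set \<Rightarrow> bool" where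
  "H_orthogonal_hor v S \<longleftrightarrow>
     (\<forall>w\<in>tangent_fields S. (\<forall>p\<in>S. w p \<in> hlayer p) \<longrightarrow> (\<forall>p\<in>S. inner_H (v p) (w p) = 0))"

definition H_orientable :: "'n::finite heis set \<Rightarrow> bool" where
  "H_orientable S \<longleftrightarrow> C1_surface S \<and> char_set S = {} \<and>
     (\<exists>nH. continuous_on S nH \<and> (\<forall>p\<in>S. nH p \<in> hlayer p \<and> nH p \<noteq> 0) \<and> H_orthogonal nH S)"

definition H_orientable_hor :: "'n::finite heis set \<Rightarrow> bool" where
  "H_orientable_hor S \<longleftrightarrow> C1_surface S \<and> char_set S = {} \<and>
     (\<exists>nH. continuous_on S nH \<and> (\<forall>p\<in>S. nH p \<in> hlayer p \<and> nH p \<noteq> 0) \<and> H_orthogonal_hor nH S)"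

end

theory Submission
  imports Defs
begin

text \<open>Left translations and dilations are both of the form \<open>F p = a * \<delta>\<^sub>s p\<close> with \<open>s > 0\<close>, and the
  inverse of such a map is again one, so every equivalence follows from one implication. \<open>F\<close> is
  affine; its constant derivative sends \<open>X j\<close>, \<open>Y j\<close> at \<open>p\<close> to \<open>s X j\<close>, \<open>s Y j\<close> at \<open>F p\<close>. It therefore
  preserves horizontal layers, commutes with taking horizontal parts and scales the horizontal
  scalar product by \<open>s\<^sup>2\<close>, so a horizontal normal of \<open>S\<close> is pushed forward to one of \<open>F S\<close>.\<close>

section \<open>Similarities and group identities\<close>

definition hsim :: "'n::finite heis \<Rightarrow> real \<Rightarrow> 'n heis \<Rightarrow> 'n heis" where
  "hsim a s p = hmul a (dil s p)"

text \<open>The linear part of the affine map \<open>hsim a s\<close>; the terms in \<open>a\<close>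
  come from the bilinear part of the group law.\<close>

definition hsim_deriv :: "'n::finite heis \<Rightarrow> real \<Rightarrow> 'n heis \<Rightarrow> 'n heis" where
  "hsim_deriv a s v = (s *\<^sub>R fst v, s *\<^sub>R fst (snd v),
     s\<^sup>2 * snd (snd v) + s / 2 * (fst a \<bullet> fst (snd v) - fst (snd a) \<bullet> fst v))"

lemma hmul_eq:
  "hmul p q = (fst p + fst q, fst (snd p) + fst (snd q),
     snd (snd p) + snd (snd q) + (fst p \<bullet> fst (snd q) - fst (snd p) \<bullet> fst q) / 2)"
  by (simp add: hmul_def inner_vec_def sum_subtractf split_beta)

lemma dil_eq: "dil r p = (r *\<^sub>R fst p, r *\<^sub>R fst (snd p), r\<^sup>2 * snd (snd p))"
  by (simp add: dil_def split_beta)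

lemma hmul_assoc: "hmul (hmul p q) u = hmul p (hmul q u)"
  by (simp add: hmul_eq inner_simps field_simps)

lemma dil_hmul: "dil r (hmul p q) = hmul (dil r p) (dil r q)"
  by (simp add: hmul_eq dil_eq prod_eq_iff algebra_simps power2_eq_square diff_divide_distrib)

lemma dil_dil: "dil r (dil s p) = dil (r * s) p"
  by (simp add: dil_eq power_mult_distrib)

lemma dil_one [simp]: "dil 1 p = p"
  by (simp add: dil_eq)

lemma hmul_0 [simp]: "hmul 0 p = p" "hmul p 0 = p"
  by (simp_all add: hmul_eq)

lemma hmul_minus [simp]: "hmul p (- p) = 0" "hmul (- p) p = 0"
  by (simp_all add: hmul_eq inner_commute prod_eq_iff)

lemma dil_0 [simp]: "dil s 0 = 0"
  by (simp add: dil_eq prod_eq_iff)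

lemma dil_minus: "dil s (- p) = - dil s p"
  by (simp add: dil_eq)

section \<open>The horizontal layer and the action of similarities on it\<close>

text \<open>The layer is the kernel of the contact form dt - (x dy - y dx) / 2: the form vanishes on
  the spanning fields, and a vector on which it vanishes equals its own horizontal part.\<close>

lemma hlayer_iff:
  "v \<in> hlayer p \<longleftrightarrow> snd (snd v) = (fst p \<bullet> fst (snd v) - fst (snd p) \<bullet> fst v) / 2"
proof
  assume "v \<in> hlayer p"
  then show "snd (snd v) = (fst p \<bullet> fst (snd v) - fst (snd p) \<bullet> fst v) / 2"
    unfolding hlayer_def
    by (induction rule: span_induct_alt)
       (auto simp: Xf_def Yf_def inner_axis inner_simps field_simps)
next
  assume *: "snd (snd v) = (fst p \<bullet> fst (snd v) - fst (snd p) \<bullet> fst v) / 2"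
  have "snd (snd (hpart p v)) = (fst p \<bullet> fst (snd v) - fst (snd p) \<bullet> fst v) / 2"
    by (simp add: hpart_def snd_sum Xf_def Yf_def inner_vec_def sum_subtractf[symmetric]
          sum_divide_distrib field_simps)
  then have "hpart p v = v"
    using * by (simp add: prod_eq_iff fst_hpart fst_snd_hpart)
  then show "v \<in> hlayer p"
    using hpart_in_hlayer by metis
qed

text \<open>An increment multiplied on the right is only dilated, not translated; this carries the
  difference quotients of P-differentiability over.\<close>

lemma hsim_hmul: "hsim a s (hmul p q) = hmul (hsim a s p) (dil s q)"
  by (simp add: hsim_def dil_hmul hmul_assoc)

lemma hsim_eq_plus_deriv: "hsim a s p = a + hsim_deriv a s p"
  by (simp add: hsim_def hsim_deriv_def hmul_eq dil_eq prod_eq_iff algebra_simps diff_divide_distrib)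

lemma linear_hsim_deriv: "linear (hsim_deriv a s)"
  by (rule linearI) (simp_all add: hsim_deriv_def prod_eq_iff inner_simps algebra_simps)

lemma bounded_linear_hsim_deriv: "bounded_linear (hsim_deriv a s)"
  by (simp add: linear_hsim_deriv linear_conv_bounded_linear[symmetric])

lemma hsim_add: "hsim a s (p + v) = hsim a s p + hsim_deriv a s v"
  by (simp add: hsim_eq_plus_deriv linear_add[OF linear_hsim_deriv])

lemma has_derivative_hsim: "(hsim a s has_derivative hsim_deriv a s) F"
  unfolding hsim_eq_plus_deriv[abs_def]
  by (auto intro!: derivative_eq_intros bounded_linear_imp_has_derivative[OF bounded_linear_hsim_deriv])

lemma continuous_on_hsim: "continuous_on A (hsim a s)"
  by (meson has_derivative_hsim has_derivative_continuous continuous_at_imp_continuous_on)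

lemma continuous_on_hsim_deriv:
  "continuous_on A f \<Longrightarrow> continuous_on A (\<lambda>x. hsim_deriv a s (f x))"
  by (rule bounded_linear.continuous_on[OF bounded_linear_hsim_deriv])

text \<open>Left invariance of the field combined with its homogeneity of degree one under
  dilations.\<close>

lemma hsim_deriv_Xf: "hsim_deriv a s (Xf j p) = s *\<^sub>R Xf j (hsim a s p)"
  by (simp add: hsim_deriv_def Xf_def hsim_def hmul_eq dil_eq inner_axis power2_eq_square algebra_simps)

lemma hsim_deriv_Yf: "hsim_deriv a s (Yf j p) = s *\<^sub>R Yf j (hsim a s p)"
  by (simp add: hsim_deriv_def Yf_def hsim_def hmul_eq dil_eq inner_axis power2_eq_square algebra_simps)

lemma hsim_deriv_hpart: "hsim_deriv a s (hpart p v) = hpart (hsim a s p) (hsim_deriv a s v)"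
  unfolding hpart_def
  by (simp add: linear_sum[OF linear_hsim_deriv] linear_add[OF linear_hsim_deriv]
      linear_scale[OF linear_hsim_deriv] hsim_deriv_Xf hsim_deriv_Yf)
     (simp add: hsim_deriv_def mult.commute)

lemma inner_H_hsim_deriv: "inner_H (hsim_deriv a s v) (hsim_deriv a s w) = s\<^sup>2 * inner_H v w"
  by (simp add: inner_H_def hsim_deriv_def algebra_simps power2_eq_square)

lemma hsim_deriv_in_hlayer:
  assumes "v \<in> hlayer p"
  shows "hsim_deriv a s v \<in> hlayer (hsim a s p)"
  unfolding hlayer_iff
  by (simp add: hsim_deriv_def hsim_def hmul_eq dil_eq inner_simps power2_eq_square
      assms[unfolded hlayer_iff] algebra_simps diff_divide_distrib add_divide_distrib)

lemma tangent_space_hsim: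
  assumes "v \<in> tangent_space S p"
  shows "hsim_deriv a s v \<in> tangent_space (hsim a s ` S) (hsim a s p)"
proof -
  obtain c e where e: "e > 0" and c: "c C1_differentiable_on {-e<..<e}"
    and im: "c ` {-e<..<e} \<subseteq> S" and c0: "c 0 = p" and v: "(c has_vector_derivative v) (at (0::real))"
    using assms unfolding tangent_space_def by blast
  have deriv: "(hsim a s \<circ> c has_vector_derivative hsim_deriv a s u) (at x)"
    if "(c has_vector_derivative u) (at x)" for u x
    using diff_chain_at[OF that[unfolded has_vector_derivative_def] has_derivative_hsim]
    by (simp add: has_vector_derivative_def o_def linear_scale[OF linear_hsim_deriv])
  obtain D where D: "\<forall>x\<in>{-e<..<e}. (c has_vector_derivative D x) (at x)"
    and contD: "continuous_on {-e<..<e} D"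
    using c unfolding C1_differentiable_on_def by blast
  have "hsim a s \<circ> c C1_differentiable_on {-e<..<e}"
    unfolding C1_differentiable_on_def
    using D deriv continuous_on_hsim_deriv[OF contD]
    by (intro exI[of _ "\<lambda>x. hsim_deriv a s (D x)"]) auto
  moreover have "(hsim a s \<circ> c) ` {-e<..<e} \<subseteq> hsim a s ` S"
    using im by auto
  ultimately show ?thesis
    unfolding tangent_space_def using e c0 deriv[OF v] by (auto simp: o_def)
qed

section \<open>P-differentiability and derivatives along the fields\<close>

text \<open>The operator \<^const>\<open>deriv\<close> in \<^const>\<open>along\<close> has an arbitrary value where the derivative does not
  exist, so its chain rule needs the existence of the derivative.\<close>

lemma P_differentiable_imp_DERIV:
  fixes u :: "'n::finite heis"
  assumes "P_differentiable_at f p"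
    and line: "\<And>\<rho>. hmul p (dil \<rho> u) = p + \<rho> *\<^sub>R w"
  shows "\<exists>D. ((\<lambda>s. f (p + s *\<^sub>R w)) has_real_derivative D) (at 0)"
proof -
  obtain L where hom: "\<forall>p q. L (hmul p q) = L p + L q"
    and lim: "\<forall>K. compact K \<longrightarrow>
      uniform_limit K (\<lambda>\<rho> q. (f (hmul p (dil \<rho> q)) - f p) / \<rho>) L (at_right 0)"
    using assms(1) unfolding P_differentiable_at_def by blast
  have "L 0 = 0"
    using hom[rule_format, of 0 0] by simp
  then have Lminus: "L (- u) = - L u"
    using hom[rule_format, of u "- u"] by simp
  have lim1: "((\<lambda>\<rho>. (f (hmul p (dil \<rho> q)) - f p) / \<rho>) \<longlongrightarrow> L q) (at_right 0)" for q
    using tendsto_uniform_limitI[OF lim[rule_format, of "{q}"]] by simp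
  \<comment> \<open>\<open>dil \<rho> (- u)\<close> and \<open>dil (- \<rho>) u\<close> differ in
    the sign of the last coordinate; the two instances of \<open>line\<close> together force
    \<open>\<rho>\<^sup>2 * snd (snd u) = 0\<close>.\<close>
  have line': "hmul p (dil \<rho> (- u)) = p - \<rho> *\<^sub>R w" for \<rho>
    using line[of "- \<rho>"] line[of \<rho>]
    by (simp add: hmul_eq dil_eq prod_eq_iff algebra_simps) (auto simp: field_simps)
  have "((\<lambda>h. (f (p + h *\<^sub>R w) - f p) / h) \<longlongrightarrow> L u) (at_right 0)"
    using lim1[of u] by (simp add: line)
  moreover have "((\<lambda>h. (f (p + h *\<^sub>R w) - f p) / h) \<longlongrightarrow> L u) (at_left 0)"
    using tendsto_minus[OF lim1[of "- u"]]
    by (simp add: at_left_minus[of 0] filterlim_filtermap line' Lminus)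
  ultimately show ?thesis
    by (intro exI[of _ "L u"]) (simp add: DERIV_def filterlim_split_at)
qed

lemma P_differentiable_imp_DERIV_Xf:
  "P_differentiable_at f p \<Longrightarrow> \<exists>D. ((\<lambda>s. f (p + s *\<^sub>R Xf j p)) has_real_derivative D) (at 0)"
  by (rule P_differentiable_imp_DERIV[where u = "(axis j 1, 0, 0)"])
     (auto simp: hmul_eq dil_eq Xf_def inner_axis prod_eq_iff)

lemma P_differentiable_imp_DERIV_Yf:
  "P_differentiable_at f p \<Longrightarrow> \<exists>D. ((\<lambda>s. f (p + s *\<^sub>R Yf j p)) has_real_derivative D) (at 0)"
  by (rule P_differentiable_imp_DERIV[where u = "(0, axis j 1, 0)"])
     (auto simp: hmul_eq dil_eq Yf_def inner_axis prod_eq_iff)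

text \<open>The line along \<open>V\<close> through \<open>p\<close> is mapped to the one through
  \<open>hsim a s p\<close>, traversed \<open>s\<close> times as fast.\<close>

lemma along_hsim:
  assumes V: "hsim_deriv a s (V p) = s *\<^sub>R V (hsim a s p)"
    and D: "\<exists>D. ((\<lambda>h. f (hsim a s p + h *\<^sub>R V (hsim a s p))) has_real_derivative D) (at 0)"
  shows "along V (f \<circ> hsim a s) p = s * along V f (hsim a s p)"
proof -
  define g where "g = (\<lambda>h. f (hsim a s p + h *\<^sub>R V (hsim a s p)))"
  obtain D where D': "(g has_real_derivative D) (at 0)"
    using D unfolding g_def by blast
  have "((\<lambda>h. g (h * s)) has_real_derivative D * s) (at 0)"
    by (rule DERIV_chain2[of g D "\<lambda>h. h * s" 0 s UNIV])
      (use D' in \<open>auto intro!: derivative_eq_intros\<close>)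
  moreover have "(f \<circ> hsim a s) (p + h *\<^sub>R V p) = g (h * s)" for h
    by (simp add: g_def hsim_add linear_scale[OF linear_hsim_deriv] V)
  ultimately show ?thesis
    using D' by (simp add: along_def DERIV_imp_deriv g_def[symmetric])
qed

text \<open>The new differential is \<open>L \<circ> dil s\<close>; uniformity survives because
  \<open>dil s\<close> maps compact sets to compact sets.\<close>

lemma P_differentiable_hsim:
  assumes "s > 0" and "P_differentiable_at f (hsim a s p)"
  shows "P_differentiable_at (f \<circ> hsim a s) p"
proof -
  obtain L where hom: "\<forall>p q. L (hmul p q) = L p + L q"
    and homog: "\<forall>\<rho>>0. \<forall>p. L (dil \<rho> p) = \<rho> * L p"
    and lim: "\<forall>K. compact K \<longrightarrow> uniform_limit K
      (\<lambda>\<rho> q. (f (hmul (hsim a s p) (dil \<rho> q)) - f (hsim a s p)) / \<rho>) L (at_right 0)"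
    using assms(2) unfolding P_differentiable_at_def by (elim exE conjE) (rule that)
  have "uniform_limit K (\<lambda>\<rho> q. ((f \<circ> hsim a s) (hmul p (dil \<rho> q)) - (f \<circ> hsim a s) p) / \<rho>)
      (L \<circ> dil s) (at_right 0)" if K: "compact K" for K
  proof -
    have "continuous_on K (dil s)"
      unfolding dil_eq by (intro continuous_intros)
    then have "compact (dil s ` K)"
      using K compact_continuous_image by blast
    then have "uniform_limit (dil s ` K)
        (\<lambda>\<rho> q. (f (hmul (hsim a s p) (dil \<rho> q)) - f (hsim a s p)) / \<rho>) L (at_right 0)"
      using lim by blast
    then show ?thesis
      by (simp add: uniform_limit_iff hsim_hmul dil_dil mult.commute)
  qed
  moreover have "(L \<circ> dil s) (dil \<rho> q) = \<rho> * (L \<circ> dil s) q" if "\<rho> > 0" for \<rho> q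
    using homog[rule_format, OF that, of "dil s q"] by (simp add: dil_dil mult.commute)
  ultimately show ?thesis
    unfolding P_differentiable_at_def
    by (intro exI[of _ "L \<circ> dil s"]) (simp add: dil_hmul hom)
qed

section \<open>Similarities paired with their inverses\<close>

text \<open>\<open>b\<close> and \<open>t\<close> are the parameters of the inverse map. Carrying
  them along makes the assumptions symmetric under exchange of the two maps.\<close>

locale heis_similarity =
  fixes a :: "'n::finite heis" and s :: real and b :: "'n heis" and t :: real
  assumes s_pos: "s > 0" and t_eq: "t = 1 / s" and b_eq: "b = dil t (- a)"
begin

lemma inverse_similarity: "heis_similarity b t a s"
  using s_pos by unfold_locales (auto simp: t_eq b_eq dil_minus dil_dil)

lemma inverse_hsim [simp]: "hsim b t (hsim a s p) = p"
  using s_pos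
  by (simp add: hsim_def b_eq t_eq dil_hmul dil_dil dil_minus hmul_assoc[symmetric])

text \<open>Compares the linear parts of the affine identity \<open>inverse_hsim\<close>, with base
  point 0.\<close>

lemma inverse_hsim_deriv [simp]: "hsim_deriv b t (hsim_deriv a s v) = v"
proof -
  have "hsim b t (hsim a s 0 + hsim_deriv a s v) = hsim b t (hsim a s 0) + v"
    by (metis add_0 inverse_hsim hsim_add)
  then show ?thesis
    by (simp add: hsim_add)
qed

end

text \<open>Makes results available under the prefix \<open>inv\<close> with the two maps
  exchanged.\<close>

sublocale heis_similarity \<subseteq> inv: heis_similarity b t a s
  by (rule inverse_similarity)

context heis_similarity
begin

abbreviation "F \<equiv> hsim a s"
abbreviation "G \<equiv> hsim b t"
abbreviation "DF \<equiv> hsim_deriv a s"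
abbreviation "DG \<equiv> hsim_deriv b t"

lemma DF_eq_0_iff: "DF v = 0 \<longleftrightarrow> v = 0"
  by (metis inverse_hsim_deriv linear_0 linear_hsim_deriv)

section \<open>Transport of Euclidean and H-regular surfaces\<close>

lemma open_vimage_G: "open U \<Longrightarrow> open (G -` U)"
  using continuous_on_hsim continuous_on_open_vimage open_UNIV by (metis Int_UNIV_right)

text \<open>\<open>F\<close> is a bijection with inverse \<open>G\<close>, so local equations are
  transported by composition with \<open>G\<close>.\<close>

lemma image_Int_vimage_G:
  assumes "S \<inter> U = {q \<in> U. f q = 0}"
  shows "F ` S \<inter> G -` U = {q \<in> G -` U. (f \<circ> G) q = 0}"
proof -
  have "q \<in> F ` S \<longleftrightarrow> G q \<in> S" for q
    using inv.inverse_hsim[of q] by (auto intro: image_eqI[of q F "G q"])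
  moreover have "p \<in> S \<longleftrightarrow> f p = 0" if "p \<in> U" for p
    using assms that by blast
  ultimately show ?thesis
    unfolding o_def by blast
qed

lemma continuous_on_comp_G:
  "continuous_on A f \<Longrightarrow> B \<subseteq> G -` A \<Longrightarrow> continuous_on B (\<lambda>q. f (G q))"
  by (rule continuous_on_compose2[OF _ continuous_on_hsim]) auto

lemma C1_surface_image:
  assumes "C1_surface S"
  shows "C1_surface (F ` S)"
  unfolding C1_surface_def
proof
  fix p' assume "p' \<in> F ` S"
  then obtain p where p: "p \<in> S" "p' = F p" by blast
  then obtain U g grad where U: "open U" "p \<in> U" and g: "\<forall>q\<in>U. GDERIV g q :> grad q"
    and cont: "continuous_on U grad" and SU: "S \<inter> U = {q \<in> U. g q = 0}"
    and nz: "\<forall>q\<in>U. grad q \<noteq> 0"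
    using bspec[OF assms[unfolded C1_surface_def] p(1)] by (elim exE conjE) (rule that)
  \<comment> \<open>By the chain rule, the gradient is pulled back by the transpose of the linear
    part of \<open>G\<close>.\<close>
  define grad' where "grad' = (\<lambda>q. adjoint DG (grad (G q)))"
  have "GDERIV (g \<circ> G) q :> grad' q" if "G q \<in> U" for q
  proof -
    have "(g has_derivative (\<lambda>h. h \<bullet> grad (G q))) (at (G q))"
      using g that unfolding gderiv_def by blast
    from diff_chain_at[OF has_derivative_hsim this] show ?thesis
      by (simp add: gderiv_def grad'_def o_def adjoint_works[OF linear_hsim_deriv])
  qed
  moreover have "continuous_on (G -` U) grad'"
    unfolding grad'_def
    by (intro bounded_linear.continuous_on[of "adjoint DG"] continuous_on_comp_G[OF cont])
       (simp_all add: adjoint_linear linear_hsim_deriv linear_conv_bounded_linear[symmetric])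
  moreover have "grad' q \<noteq> 0" if "G q \<in> U" for q
  proof
    assume "grad' q = 0"
    \<comment> \<open>Moving the adjoint across turns this product into the squared norm of
      \<open>grad (G q)\<close>, as \<open>DG\<close> inverts \<open>DF\<close>.\<close>
    then have "DF (grad (G q)) \<bullet> grad' q = 0" by simp
    then show False
      using nz that by (simp add: grad'_def adjoint_works[OF linear_hsim_deriv])
  qed
  ultimately show "\<exists>U g grad. open U \<and> p' \<in> U \<and> (\<forall>q\<in>U. GDERIV g q :> grad q) \<and>
      continuous_on U grad \<and> F ` S \<inter> U = {q \<in> U. g q = 0} \<and> (\<forall>q\<in>U. grad q \<noteq> 0)"
    using open_vimage_G[OF U(1)] U(2) p(2) image_Int_vimage_G[OF SU]
    by (intro exI[of _ "G -` U"] exI[of _ "g \<circ> G"] exI[of _ grad']) simp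
qed

text \<open>The coefficients scale by \<open>t\<close>, and the frame at \<open>q\<close> is
  \<open>t\<close> times the image under \<open>DF\<close> of the frame at \<open>G q\<close>; hence
  the factor \<open>t\<^sup>2\<close>.\<close>

lemma hgrad_comp_G:
  assumes "P_differentiable_at f (G q)"
  shows "hgrad (f \<circ> G) q = t\<^sup>2 *\<^sub>R DF (hgrad f (G q))"
proof -
  have along: "along (Xf j) (f \<circ> G) q = t * along (Xf j) f (G q)"
    "along (Yf j) (f \<circ> G) q = t * along (Yf j) f (G q)" for j
    by (intro along_hsim hsim_deriv_Xf hsim_deriv_Yf P_differentiable_imp_DERIV_Xf
        P_differentiable_imp_DERIV_Yf assms)+
  have ts: "t * (t * (u * s)) = t * u" for u
    using s_pos by (simp add: t_eq)
  show ?thesis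
    by (simp add: along ts hgrad_def linear_sum[OF linear_hsim_deriv] linear_add[OF linear_hsim_deriv]
        linear_scale[OF linear_hsim_deriv] hsim_deriv_Xf hsim_deriv_Yf scaleR_sum_right
        scaleR_add_right power2_eq_square mult.assoc)
qed

lemma H_regular_surface_image:
  assumes "H_regular_surface S"
  shows "H_regular_surface (F ` S)"
  unfolding H_regular_surface_def
proof
  fix p' assume "p' \<in> F ` S"
  then obtain p where p: "p \<in> S" "p' = F p" by blast
  then obtain U f where U: "open U" "p \<in> U" and f: "C1_H_on U f"
    and SU: "S \<inter> U = {q \<in> U. f q = 0}" and nz: "\<forall>q\<in>U. hgrad f q \<noteq> 0"
    using bspec[OF assms[unfolded H_regular_surface_def] p(1)] by (elim exE conjE) (rule that)
  have cont: "continuous_on U f" and contg: "continuous_on U (hgrad f)"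
    and P: "\<And>q. q \<in> U \<Longrightarrow> P_differentiable_at f q"
    using f unfolding C1_H_on_def by auto
  have grad: "hgrad (f \<circ> G) q = t\<^sup>2 *\<^sub>R DF (hgrad f (G q))" if "q \<in> G -` U" for q
    using that by (intro hgrad_comp_G P) auto
  have "continuous_on (G -` U) (\<lambda>q. t\<^sup>2 *\<^sub>R DF (hgrad f (G q)))"
    by (intro continuous_intros continuous_on_hsim_deriv continuous_on_comp_G[OF contg]) simp
  then have "continuous_on (G -` U) (hgrad (f \<circ> G))"
    by (rule continuous_on_eq) (simp add: grad)
  moreover have "continuous_on (G -` U) (f \<circ> G)"
    unfolding o_def by (intro continuous_on_comp_G[OF cont]) simp
  moreover have "P_differentiable_at (f \<circ> G) q" if "q \<in> G -` U" for q
    using that by (intro P_differentiable_hsim inv.s_pos P) auto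
  ultimately have "C1_H_on (G -` U) (f \<circ> G)"
    unfolding C1_H_on_def by blast
  moreover have "hgrad (f \<circ> G) q \<noteq> 0" if "q \<in> G -` U" for q
    using grad[OF that] nz that inv.s_pos by (simp add: DF_eq_0_iff)
  ultimately show "\<exists>U f. open U \<and> p' \<in> U \<and> C1_H_on U f \<and> F ` S \<inter> U = {q \<in> U. f q = 0} \<and>
        (\<forall>q\<in>U. hgrad f q \<noteq> 0)"
    using open_vimage_G[OF U(1)] U(2) p(2) image_Int_vimage_G[OF SU]
    by (intro exI[of _ "G -` U"] exI[of _ "f \<circ> G"]) simp
qed

section \<open>Characteristic set, tangent fields and horizontal normals\<close>

lemma image_image_G [simp]: "G ` F ` S = S"
  by (simp add: image_image)

lemma DG_in_hlayer: "v \<in> hlayer (F p) \<Longrightarrow> DG v \<in> hlayer p"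
  by (metis hsim_deriv_in_hlayer inverse_hsim)

lemma DG_in_tangent_space: "v \<in> tangent_space (F ` S) (F p) \<Longrightarrow> DG v \<in> tangent_space S p"
  by (metis tangent_space_hsim inverse_hsim image_image_G)

text \<open>If the image had a characteristic point \<open>F p\<close>, then each \<open>v\<close>
  tangent to \<open>S\<close> at \<open>p\<close> would be horizontal, being \<open>DG\<close> of
  the horizontal vector \<open>DF v\<close>.\<close>

lemma char_set_image:
  assumes "char_set S = {}"
  shows "char_set (F ` S) = {}"
proof -
  have "p \<in> char_set S" if p: "p \<in> S" "tangent_space (F ` S) (F p) \<subseteq> hlayer (F p)" for p
    unfolding char_set_def
    using p tangent_space_hsim DG_in_hlayer inverse_hsim_deriv by (smt (verit) mem_Collect_eq subset_iff)
  with assms show ?thesis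
    unfolding char_set_def by blast
qed

lemma tangent_fields_pullback:
  assumes "w \<in> tangent_fields (F ` S)"
  shows "(\<lambda>p. DG (w (F p))) \<in> tangent_fields S"
proof -
  have "continuous_on S (\<lambda>p. w (F p))"
    using assms unfolding tangent_fields_def
    by (intro continuous_on_compose2[OF _ continuous_on_hsim]) auto
  then show ?thesis
    using assms unfolding tangent_fields_def
    by (auto intro: continuous_on_hsim_deriv DG_in_tangent_space)
qed

text \<open>Up to the factor \<open>s\<^sup>2\<close>, \<open>DG\<close> is the adjoint of
  \<open>DF\<close> for \<open>inner_H\<close>; this shifts the map from the normal to the tangent
  field.\<close>

lemma inner_H_DF: "inner_H (DF v) w = s\<^sup>2 * inner_H v (DG w)"
  by (metis inner_H_hsim_deriv inv.inverse_hsim_deriv)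

text \<open>Works because \<open>DG\<close> commutes with taking horizontal parts.\<close>

lemma H_orthogonal_image:
  assumes "H_orthogonal v S"
  shows "H_orthogonal (\<lambda>q. DF (v (G q))) (F ` S)"
  unfolding H_orthogonal_def
proof (intro ballI, elim imageE)
  fix w q p assume w: "w \<in> tangent_fields (F ` S)" and p: "p \<in> S" "q = F p"
  have "inner_H (v p) (hpart p (DG (w (F p)))) = 0"
    using bspec[OF assms[unfolded H_orthogonal_def] tangent_fields_pullback[OF w]] p(1) by blast
  then show "inner_H (DF (v (G q))) (hpart q (w q)) = 0"
    by (simp add: inner_H_DF hsim_deriv_hpart p(2))
qed

text \<open>Under this reading the pulled-back test field must itself be horizontal, which
  \<open>DG_in_hlayer\<close> supplies.\<close>

lemma H_orthogonal_hor_image: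
  assumes "H_orthogonal_hor v S"
  shows "H_orthogonal_hor (\<lambda>q. DF (v (G q))) (F ` S)"
  unfolding H_orthogonal_hor_def
proof (intro ballI impI, elim imageE)
  fix w q p assume w: "w \<in> tangent_fields (F ` S)" "\<forall>p\<in>F ` S. w p \<in> hlayer p"
    and p: "p \<in> S" "q = F p"
  have "\<forall>p\<in>S. DG (w (F p)) \<in> hlayer p"
    using w(2) DG_in_hlayer by blast
  then have "inner_H (v p) (DG (w (F p))) = 0"
    using bspec[OF assms[unfolded H_orthogonal_hor_def] tangent_fields_pullback[OF w(1)]] p(1) by blast
  then show "inner_H (DF (v (G q))) (w q) = 0"
    by (simp add: inner_H_DF p(2))
qed

lemma horizontal_field_pushforward:
  assumes "continuous_on S v" and "\<forall>p\<in>S. v p \<in> hlayer p \<and> v p \<noteq> 0"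
  shows "continuous_on (F ` S) (\<lambda>q. DF (v (G q)))"
    and "\<forall>q\<in>F ` S. DF (v (G q)) \<in> hlayer q \<and> DF (v (G q)) \<noteq> 0"
  using assms
  by (auto intro!: continuous_on_hsim_deriv continuous_on_comp_G hsim_deriv_in_hlayer
      simp: DF_eq_0_iff)

lemma H_orientable_image: "H_orientable S \<Longrightarrow> H_orientable (F ` S)"
  unfolding H_orientable_def
  \<comment> \<open>The witness stays schematic until the continuity goal fixes it as the
    pushforward of the given normal.\<close>
  by (elim exE conjE, intro conjI exI)
     (rule C1_surface_image char_set_image horizontal_field_pushforward H_orthogonal_image; assumption)+

lemma H_orientable_hor_image: "H_orientable_hor S \<Longrightarrow> H_orientable_hor (F ` S)"
  unfolding H_orientable_hor_def
  by (elim exE conjE, intro conjI exI)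
     (rule C1_surface_image char_set_image horizontal_field_pushforward H_orthogonal_hor_image; assumption)+

end

section \<open>The equivalences and their two special cases\<close>

context heis_similarity
begin

lemma H_orientable_image_iff: "H_orientable (F ` S) \<longleftrightarrow> H_orientable S"
  using H_orientable_image inv.H_orientable_image[of "F ` S"] by auto

lemma H_orientable_hor_image_iff: "H_orientable_hor (F ` S) \<longleftrightarrow> H_orientable_hor S"
  using H_orientable_hor_image inv.H_orientable_hor_image[of "F ` S"] by auto

end

theorem proposition2p19:
  fixes pbar :: "'n::finite heis" and r :: real and S :: "'n heis set"
  assumes "r > 0"
    and "H_regular_surface S"
    and "C1_surface S"
    and "char_set S = {}"
  shows "H_regular_surface (left_transl pbar ` S) \<and> H_regular_surface (dil r ` S) \<and>
    (H_orientable (left_transl pbar ` S) \<longleftrightarrow> H_orientable S) \<and>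
    (H_orientable (dil r ` S) \<longleftrightarrow> H_orientable S) \<and>
    (H_orientable_hor (left_transl pbar ` S) \<longleftrightarrow> H_orientable_hor S) \<and>
    (H_orientable_hor (dil r ` S) \<longleftrightarrow> H_orientable_hor S)"
proof -
  \<comment> \<open>Translations are the similarities with dilation factor 1, dilations those with
    translation part 0.\<close>
  interpret transl: heis_similarity pbar 1 "dil 1 (- pbar)" 1
    by unfold_locales simp_all
  interpret dilation: heis_similarity "0 :: 'n heis" r "dil (1 / r) (- 0)" "1 / r"
    using \<open>r > 0\<close> by unfold_locales simp_all
  have "left_transl pbar = hsim pbar 1" "dil r = hsim (0 :: 'n heis) r"
    by (simp_all add: fun_eq_iff left_transl_def hsim_def)
  then show ?thesis
    using transl.H_regular_surface_image[OF assms(2)] dilation.H_regular_surface_image[OF assms(2)]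
      transl.H_orientable_image_iff dilation.H_orientable_image_iff
      transl.H_orientable_hor_image_iff dilation.H_orientable_hor_image_iff
    by simp
qed

end
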